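(* Let $k\ge 2$ and $n\ge 1$ be integers, let $m>1$ be real, let $a<b$ be real numbers, let $x_1,\dots,x_n\in[a,b]$, and let $V=(v_1,\dots,v_k)$ be ordered centroids with $a<v_1<\cdots<v_k<b$; put $v_0:=a$, $v_{k+1}:=b$. Let $U=(u_{ij})$ be the membership matrix associated with $V$ and $m$ (defined in the context), and for $j=1,\dots,k$ let $V_j$ denote the membership function of cluster $j$ obtained by interpolation of the values $u_{ij}$ over $x$ considering the centroids $V$ (defined in the context). Then for every $j=1,\dots,k$: - $V_j(v_j)=1$ (normality); - the support of $V_j$ is contained in $[v_{j-1},v_{j+1}]$; - $V_j$ is monotone increasing (in the weak sense) on $[v_{j-1},v_j]$ and monotone decreasing (in the weak sense) on $[v_j,v_{j+1}]$. Hence each $V_j$ is a fuzzy number, and the collection $\{V_1,\dots,V_k\}$ is a fuzzy partition of $[a,b]$.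
   Context: Fuzzy numbers: a fuzzy set on $\mathbb{R}$ is a map $A:\mathbb{R}\to[0,1]$. For $\alpha\in(0,1]$ its $\alpha$-cut is $A^\alpha=\{x\in\mathbb{R}: A(x)\ge\alpha\}$; $A^0$, called the support of $A$, is the topological closure of $\{x: A(x)>0\}$. $A$ is a fuzzy number if (i) $A^1\ne\emptyset$, (ii) $A^\alpha$ is an interval for every $\alpha\in[0,1]$, and (iii) $A^0$ is bounded. A family $A_1,\dots,A_k$ of fuzzy numbers is a fuzzy partition over $[a,b]$ if $\sum_{j=1}^k A_j(x)=1$ for all $x\in[a,b]$. Membership matrix: let $d_{ij}=(x_i-v_j)^2$. Let $j(i)\in\{0,\dots,k\}$ be the unique index with $v_{j(i)}\le x_i<v_{j(i)+1}$ (and $j(i)=k$ if $x_i=b$). The matrix $U=(u_{ij})\in[0,1]^{n\times k}$ is defined row by row, with $j=j(i)$ and all entries not listed equal to zero. If $1\le j\le k-1$ and $d_{i,j},d_{i,j+1}>0$, then $u_{i,j}=\big(1+(d_{i,j}/d_{i,j+1})^{1/(m-1)}\big)^{-1}$ and $u_{i,j+1}=\big(1+(d_{i,j+1}/d_{i,j})^{1/(m-1)}\big)^{-1}$. If $1\le j\le k-1$ and $d_{i,j}=0$, then $u_{i,j}=1$. If $j=0$, then $u_{i,1}=1$; if $j=k$, then $u_{i,k}=1$. Interpolated membership functions: $V_j:\mathbb{R}\to[0,1]$ is zero outside $[a,b]$, and on $[a,b]$ it is the piecewise-linear interpolation of the following nodes: $(x_i,u_{ij})$ for $i=1,\dots,n$;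 $(v_\ell,\delta_{\ell j})$ for $\ell=1,\dots,k$, where $\delta_{\ell j}=1$ if $\ell=j$ and $0$ otherwise; and the endpoint nodes $(a,\delta_{1j})$ and $(b,\delta_{kj})$. (Nodes with the same abscissa have the same ordinate.) *)

theory Defs
  imports "HOL-Analysis.Analysis"
begin

text \<open>The \<open>0\<close>-cut is the support, i.e. a topological closure, and not \<open>{x. A x \<ge> 0}\<close>.\<close>

definition alpha_cut :: "(real \<Rightarrow> real) \<Rightarrow> real \<Rightarrow> real set" where
  "alpha_cut A \<alpha> = (if \<alpha> = 0 then closure {x. A x > 0} else {x. A x \<ge> \<alpha>})"

definition fuzzy_set :: "(real \<Rightarrow> real) \<Rightarrow> bool" where
  "fuzzy_set A \<longleftrightarrow> range A \<subseteq> {0..1}"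

definition fuzzy_number :: "(real \<Rightarrow> real) \<Rightarrow> bool" where
  "fuzzy_number A \<longleftrightarrow>
     fuzzy_set A \<and> alpha_cut A 1 \<noteq> {} \<and> (\<forall>\<alpha>\<in>{0..1}. is_interval (alpha_cut A \<alpha>)) \<and>
     bounded (alpha_cut A 0)"

definition fuzzy_partition :: "nat \<Rightarrow> (nat \<Rightarrow> real \<Rightarrow> real) \<Rightarrow> real \<Rightarrow> real \<Rightarrow> bool" where
  "fuzzy_partition k A a b \<longleftrightarrow>
     (\<forall>j\<in>{1..k}. fuzzy_number (A j)) \<and> (\<forall>t\<in>{a..b}. (\<Sum>j=1..k. A j t) = 1)"

text \<open>Centroids are a sequence \<open>v\<close> of which the values \<open>v 0 = a\<close>, \<open>v 1, \<dots>, v k\<close>,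
  \<open>v (k + 1) = b\<close> matter; data points are \<open>x 1, \<dots>, x n\<close>.\<close>

definition cell_index :: "nat \<Rightarrow> real \<Rightarrow> (nat \<Rightarrow> real) \<Rightarrow> real \<Rightarrow> nat" where
  "cell_index k b v t = (if t = b then k else (THE j. j \<le> k \<and> v j \<le> t \<and> t < v (j + 1)))"

definition sq_dist :: "(nat \<Rightarrow> real) \<Rightarrow> (nat \<Rightarrow> real) \<Rightarrow> nat \<Rightarrow> nat \<Rightarrow> real" where
  "sq_dist x v i j = (x i - v j)\<^sup>2"

text \<open>In the branches with \<open>powr\<close> both squared distances are positive, because
  \<open>x i < v (c + 1)\<close> by choice of \<open>c\<close>.\<close>

definition membership ::
  "nat \<Rightarrow> real \<Rightarrow> real \<Rightarrow> (nat \<Rightarrow> real) \<Rightarrow> (nat \<Rightarrow> real) \<Rightarrow> nat \<Rightarrow> nat \<Rightarrow> real" where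
  "membership k m b x v i j =
     (let c = cell_index k b v (x i); d = sq_dist x v i in
      if c = 0 then (if j = 1 then 1 else 0)
      else if c = k then (if j = k then 1 else 0)
      else if d c = 0 then (if j = c then 1 else 0)
      else if j = c then inverse (1 + (d c / d (c + 1)) powr (1 / (m - 1)))
      else if j = c + 1 then inverse (1 + (d (c + 1) / d c) powr (1 / (m - 1)))
      else 0)"

text \<open>Piecewise-linear interpolation of a finite set of nodes (abscissa, ordinate) with
  pairwise distinct abscissae, for \<open>t\<close> between the extreme abscissae. If \<open>t\<close> is itself an
  abscissa then \<open>l = r = t\<close>, and since division by zero yields zero the value is \<open>y t\<close>.\<close>

definition pw_linear :: "(real \<times> real) set \<Rightarrow> real \<Rightarrow> real" where
  "pw_linear N t =
     (let y = (\<lambda>s. THE z. (s, z) \<in> N);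
          l = Max {s \<in> fst ` N. s \<le> t};
          r = Min {s \<in> fst ` N. t \<le> s}
      in y l + (t - l) / (r - l) * (y r - y l))"

definition nodes ::
  "nat \<Rightarrow> nat \<Rightarrow> real \<Rightarrow> real \<Rightarrow> real \<Rightarrow> (nat \<Rightarrow> real) \<Rightarrow> (nat \<Rightarrow> real) \<Rightarrow> nat \<Rightarrow> (real \<times> real) set"
where
  "nodes n k m a b x v j =
     (\<lambda>i. (x i, membership k m b x v i j)) ` {1..n} \<union>
     (\<lambda>l. (v l, if l = j then 1 else 0)) ` {1..k} \<union>
     {(a, if j = 1 then 1 else 0), (b, if j = k then 1 else 0)}"

definition cluster_fun ::
  "nat \<Rightarrow> nat \<Rightarrow> real \<Rightarrow> real \<Rightarrow> real \<Rightarrow> (nat \<Rightarrow> real) \<Rightarrow> (nat \<Rightarrow> real) \<Rightarrow> nat \<Rightarrow> real \<Rightarrow> real"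
where
  "cluster_fun n k m a b x v j t =
     (if t \<in> {a..b} then pw_linear (nodes n k m a b x v j) t else 0)"

end

theory Submission
  imports Defs
begin

text \<open>
  The rows of the membership matrix are values of fixed functions of the position of a data point:
  for each cluster \<open>j\<close> there is a function \<open>grade j\<close> on \<open>[a, b]\<close>, depending on the centroids only, with
  \<open>u\<^sub>i\<^sub>j = grade j (x i)\<close>. The prescribed ordinates at the centroids and at \<open>a\<close> and \<open>b\<close> are also values of
  \<open>grade j\<close>. So all nodes of the \<open>j\<close>-th membership function lie on the graph of \<open>grade j\<close>, and the
  interpolation takes place over a finite set of knots that does not depend on \<open>j\<close>.

  Between consecutive knots an interpolant is a convex combination of two values of the
  interpolated function, with weights that depend on the knots only. Therefore interpolation
  preserves bounds (\<open>pw_linear_bounds\<close>) and monotonicity (\<open>pw_linear_mono\<close>) on every interval whose end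
  points are knots, and it commutes with sums over \<open>j\<close> (\<open>pw_linear_sum\<close>). As the centroids, \<open>a\<close> and
  \<open>b\<close> are knots, it suffices to prove everything for \<open>grade j\<close>.

  Between two neighbouring centroids \<open>v c\<close> and \<open>v (c + 1)\<close> only the clusters \<open>c\<close> and \<open>c + 1\<close> have a
  nonzero grade. With distances \<open>s\<close> to \<open>v c\<close> and \<open>w\<close> to \<open>v (c + 1)\<close> and \<open>q = 2 / (m - 1)\<close>, these grades
  are \<open>w\<^sup>q / (w\<^sup>q + s\<^sup>q)\<close> and \<open>s\<^sup>q / (w\<^sup>q + s\<^sup>q)\<close> (\<open>grade_middle\<close>). This form of the membership formula covers
  both centroids as well, the two grades visibly add up to one, and the first falls while the
  second rises as the point moves from \<open>v c\<close> to \<open>v (c + 1)\<close>. In the two outer cells the grade of the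
  only cluster present is constantly one. Hence \<open>grade j\<close> rises from \<open>v (j - 1)\<close> to \<open>v j\<close>, falls
  from \<open>v j\<close> to \<open>v (j + 1)\<close>, and vanishes in every cell other than these two; the interpolant inherits
  this. A function of this shape is a fuzzy number (\<open>unimodal_imp_fuzzy_number\<close>), since all its cuts
  are intervals.
\<close>

section \<open>Unimodal functions are fuzzy numbers\<close>

text \<open>A function that rises up to \<open>p\<close> and falls afterwards takes, between two points, nowhere a value
  below both of the end values; so its superlevel sets are intervals. The \<open>0\<close>-cut is the closure
  of such a set, and closures of intervals are intervals.\<close>

lemma unimodal_imp_fuzzy_number:
  assumes range: "\<And>t. A t \<in> {0..1}" and peak: "A p = 1"
    and up: "mono_on {..p} A" and down: "antimono_on {p..} A"
    and outside: "\<And>t. t \<notin> {lo..hi} \<Longrightarrow> A t = 0"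
  shows "fuzzy_number A" and "alpha_cut A 0 \<subseteq> {lo..hi}"
proof -
  have between: "A s \<le> A t \<or> A u \<le> A t" if "s \<le> t" "t \<le> u" for s t u
  proof (cases "t \<le> p")
    case True
    then show ?thesis using that by (auto intro: mono_onD[OF up])
  next
    case False
    then show ?thesis using that by (auto intro: antimonoD monotone_onD[OF down])
  qed
  have "{t. A t > 0} \<subseteq> {lo..hi}"
    using outside by force
  then show support: "alpha_cut A 0 \<subseteq> {lo..hi}"
    unfolding alpha_cut_def by (simp add: closure_minimal)
  have "is_interval {t. A t > 0}"
    unfolding is_interval_1 using between by (auto; metis order_less_le_trans)
  then have "is_interval (closure {t. A t > 0})"
    by (simp add: is_interval_convex_1 convex_closure)
  moreover have "is_interval {t. A t \<ge> \<alpha>}" for \<alpha>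
    unfolding is_interval_1 using between by (auto; metis order_trans)
  ultimately have "is_interval (alpha_cut A \<alpha>)" for \<alpha>
    by (simp add: alpha_cut_def)
  moreover have "bounded (alpha_cut A 0)"
    using support by (rule bounded_subset[rotated]) simp
  moreover have "p \<in> alpha_cut A 1"
    using peak by (simp add: alpha_cut_def)
  ultimately show "fuzzy_number A"
    using range by (auto simp: fuzzy_number_def fuzzy_set_def)
qed

section \<open>Piecewise linear interpolation of a function on finitely many knots\<close>

definition chord :: "(real \<Rightarrow> real) \<Rightarrow> real \<Rightarrow> real \<Rightarrow> real \<Rightarrow> real" where
  "chord g l r t = g l + (t - l) / (r - l) * (g r - g l)"

lemma chord_weight:
  fixes l r t :: real
  assumes "l \<le> t" "t \<le> r"
  shows "(t - l) / (r - l) \<in> {0..1}"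
  using assms by (cases "l = r") (auto simp: divide_simps)

lemma chord_bounds:
  assumes "l \<le> t" "t \<le> r" and "g l \<in> {lo..hi}" "g r \<in> {lo..hi}"
  shows "chord g l r t \<in> {lo..hi}"
proof -
  define w where "w = (t - l) / (r - l)"
  have "chord g l r t = (1 - w) *\<^sub>R g l + w *\<^sub>R g r"
    unfolding chord_def w_def[symmetric] by (simp add: algebra_simps)
  also have "\<dots> \<in> {lo..hi}"
    using chord_weight[OF assms(1,2)] assms(3,4) unfolding w_def
    by (intro convexD_alt[OF convex_real_interval(5)]) auto
  finally show ?thesis .
qed

lemma chord_uminus: "chord (\<lambda>s. - g s) l r t = - chord g l r t"
proof -
  have "- g r - - g l = - (g r - g l)"
    by simp
  then show ?thesis
    unfolding chord_def by (simp only: mult_minus_right minus_add_distrib)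
qed

lemma chord_sum: "(\<Sum>j\<in>J. chord (g j) l r t) = chord (\<lambda>s. \<Sum>j\<in>J. g j s) l r t"
  unfolding chord_def sum.distrib sum_distrib_left[symmetric] sum_subtractf ..

lemma chord_mono:
  assumes "l \<le> r" "g l \<le> g r" "s \<le> t"
  shows "chord g l r s \<le> chord g l r t"
  unfolding chord_def using assms
  by (intro add_left_mono mult_right_mono divide_right_mono) auto

definition lower_knot :: "real set \<Rightarrow> real \<Rightarrow> real" where
  "lower_knot S t = Max {s \<in> S. s \<le> t}"

definition upper_knot :: "real set \<Rightarrow> real \<Rightarrow> real" where
  "upper_knot S t = Min {s \<in> S. t \<le> s}"

definition graph_on :: "real set \<Rightarrow> (real \<Rightarrow> real) \<Rightarrow> (real \<times> real) set" where
  "graph_on S g = (\<lambda>s. (s, g s)) ` S"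

text \<open>The knots may extend beyond \<open>[p, q]\<close>. Because \<open>p\<close> and \<open>q\<close> are knots themselves, the neighbouring
  knots of a point of \<open>[p, q]\<close> stay in \<open>[p, q]\<close>, which makes the interpolant there depend only on the
  values at knots in \<open>[p, q]\<close>. This locality permits a separate argument on each cell.\<close>

locale knot_interval =
  fixes S :: "real set" and p q :: real
  assumes finite_knots: "finite S" and ends: "p \<in> S" "q \<in> S"
begin

lemma lower_knot:
  assumes "t \<in> {p..q}"
  shows "lower_knot S t \<in> S \<inter> {p..q}" and "lower_knot S t \<le> t"
    and "s \<in> S \<Longrightarrow> s \<le> t \<Longrightarrow> s \<le> lower_knot S t"
proof -
  have fin: "finite {s \<in> S. s \<le> t}" and p: "p \<in> {s \<in> S. s \<le> t}"
    using finite_knots ends assms by auto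
  have "lower_knot S t \<in> {s \<in> S. s \<le> t}"
    unfolding lower_knot_def using Max_in[OF fin] p by blast
  moreover have "p \<le> lower_knot S t"
    unfolding lower_knot_def using Max_ge[OF fin p] .
  ultimately show "lower_knot S t \<in> S \<inter> {p..q}" "lower_knot S t \<le> t"
    using assms by auto
  show "s \<le> lower_knot S t" if "s \<in> S" "s \<le> t"
    unfolding lower_knot_def using Max_ge[OF fin] that by auto
qed

lemma upper_knot:
  assumes "t \<in> {p..q}"
  shows "upper_knot S t \<in> S \<inter> {p..q}" and "t \<le> upper_knot S t"
    and "s \<in> S \<Longrightarrow> t \<le> s \<Longrightarrow> upper_knot S t \<le> s"
proof -
  have fin: "finite {s \<in> S. t \<le> s}" and q: "q \<in> {s \<in> S. t \<le> s}"
    using finite_knots ends assms by auto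
  have "upper_knot S t \<in> {s \<in> S. t \<le> s}"
    unfolding upper_knot_def using Min_in[OF fin] q by blast
  moreover have "upper_knot S t \<le> q"
    unfolding upper_knot_def using Min_le[OF fin q] .
  ultimately show "upper_knot S t \<in> S \<inter> {p..q}" "t \<le> upper_knot S t"
    using assms by auto
  show "upper_knot S t \<le> s" if "s \<in> S" "t \<le> s"
    unfolding upper_knot_def using Min_le[OF fin] that by auto
qed

lemma pw_linear_graph:
  assumes "t \<in> {p..q}"
  shows "pw_linear (graph_on S g) t = chord g (lower_knot S t) (upper_knot S t) t"
proof -
  have ordinate: "(THE z. (s, z) \<in> graph_on S g) = g s" if "s \<in> S" for s
    using that by (auto simp: graph_on_def)
  have "fst ` graph_on S g = S"
    by (force simp: graph_on_def)
  then show ?thesis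
    using lower_knot(1)[OF assms] upper_knot(1)[OF assms]
    by (simp add: pw_linear_def Let_def chord_def ordinate flip: lower_knot_def upper_knot_def)
qed

lemma pw_linear_at_knot:
  assumes "s \<in> S \<inter> {p..q}"
  shows "pw_linear (graph_on S g) s = g s"
proof -
  have s: "s \<in> S" "s \<in> {p..q}"
    using assms by auto
  have "lower_knot S s = s"
    using lower_knot(2,3)[OF s(2)] s(1) by (meson order_antisym order_refl)
  moreover have "upper_knot S s = s"
    using upper_knot(2,3)[OF s(2)] s(1) by (meson order_antisym order_refl)
  ultimately show ?thesis
    using pw_linear_graph[OF s(2)] by (simp add: chord_def)
qed

lemma pw_linear_bounds:
  assumes "\<And>s. s \<in> S \<inter> {p..q} \<Longrightarrow> g s \<in> {lo..hi}" and t: "t \<in> {p..q}"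
  shows "pw_linear (graph_on S g) t \<in> {lo..hi}"
  unfolding pw_linear_graph[OF t] using lower_knot[OF t] upper_knot[OF t]
  by (intro chord_bounds assms) auto

text \<open>On one chord this is the monotonicity of an affine function. Two different chords are
  compared through the values at the knots between them.\<close>

lemma pw_linear_mono:
  assumes g: "mono_on (S \<inter> {p..q}) g"
  shows "mono_on {p..q} (pw_linear (graph_on S g))"
proof (rule mono_onI)
  fix s t assume s: "s \<in> {p..q}" and t: "t \<in> {p..q}" and "s \<le> t"
  note ls = lower_knot[OF s] and us = upper_knot[OF s]
  note lt = lower_knot[OF t] and ut = upper_knot[OF t]
  have gs: "g (lower_knot S s) \<le> g (upper_knot S s)"
    using ls us by (intro mono_onD[OF g]) auto
  have gt: "g (lower_knot S t) \<le> g (upper_knot S t)"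
    using lt ut by (intro mono_onD[OF g]) auto
  show "pw_linear (graph_on S g) s \<le> pw_linear (graph_on S g) t"
  proof (cases "upper_knot S s \<le> t")
    case True
    have "chord g (lower_knot S s) (upper_knot S s) s \<in> {g (lower_knot S s)..g (upper_knot S s)}"
      using ls us gs by (intro chord_bounds) auto
    moreover have "g (upper_knot S s) \<le> g (lower_knot S t)"
      using us lt True by (intro mono_onD[OF g]) auto
    moreover have "chord g (lower_knot S t) (upper_knot S t) t \<in> {g (lower_knot S t)..g (upper_knot S t)}"
      using lt ut gt by (intro chord_bounds) auto
    ultimately show ?thesis
      by (simp add: pw_linear_graph[OF s] pw_linear_graph[OF t])
  next
    case False
    \<comment> \<open>No knot lies in \<open>[s, t]\<close>, so both points belong to the same chord.\<close>
    have "lower_knot S t \<le> s"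
      using False lt(1,2) us(3)[of "lower_knot S t"] by force
    then have "lower_knot S t = lower_knot S s"
      using lt ls \<open>s \<le> t\<close> by (intro order_antisym) auto
    moreover have "upper_knot S t = upper_knot S s"
      using ut us \<open>s \<le> t\<close> False by (intro order_antisym) auto
    ultimately show ?thesis
      using gs ls us \<open>s \<le> t\<close> by (simp add: pw_linear_graph[OF s] pw_linear_graph[OF t] chord_mono)
  qed
qed

lemma pw_linear_antimono:
  assumes g: "antimono_on (S \<inter> {p..q}) g"
  shows "antimono_on {p..q} (pw_linear (graph_on S g))"
proof -
  have "mono_on {p..q} (pw_linear (graph_on S (\<lambda>s. - g s)))"
    using g by (intro pw_linear_mono) (simp add: monotone_on_def)
  moreover have "pw_linear (graph_on S (\<lambda>s. - g s)) t = - pw_linear (graph_on S g) t"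
    if "t \<in> {p..q}" for t
    by (simp add: pw_linear_graph[OF that] chord_uminus)
  ultimately show ?thesis
    by (simp add: monotone_on_def)
qed

text \<open>The neighbouring knots of \<open>t\<close> are the same for all \<open>j\<close>, so the interpolant is linear in the
  interpolated function.\<close>

lemma pw_linear_sum:
  assumes t: "t \<in> {p..q}"
  shows "(\<Sum>j\<in>J. pw_linear (graph_on S (g j)) t) = pw_linear (graph_on S (\<lambda>s. \<Sum>j\<in>J. g j s)) t"
  by (simp add: pw_linear_graph[OF t] chord_sum)

end

section \<open>The share of one of two competing clusters\<close>

text \<open>For two clusters at distances \<open>s\<close> and \<open>w\<close> from a point, \<open>share q w s\<close> is the fuzzy \<open>c\<close>-means
  membership in the cluster at distance \<open>s\<close>, with the ratio of distances cleared of
  denominators. Since \<open>0 powr q = 0\<close>, the formula gives the desired values \<open>1\<close> and \<open>0\<close> also at the two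
  cluster centres, where one ratio degenerates.\<close>

definition share :: "real \<Rightarrow> real \<Rightarrow> real \<Rightarrow> real" where
  "share q w s = w powr q / (w powr q + s powr q)"

lemma share_bounds: "share q w s \<in> {0..1}"
proof -
  have "y / (y + z) \<in> {0..1}" if "0 \<le> y" "0 \<le> z" for y z :: real
    using that by (auto simp: divide_simps)
  then show ?thesis
    unfolding share_def by simp
qed

lemma share_add:
  assumes "w \<noteq> 0 \<or> s \<noteq> 0"
  shows "share q w s + share q s w = 1"
proof -
  have "w powr q + s powr q > 0"
    using assms by (auto intro: add_pos_nonneg add_nonneg_pos)
  then show ?thesis
    by (simp add: share_def add.commute flip: add_divide_distrib)
qed

text \<open>After cross-multiplication, and with \<open>W\<close>, \<open>S\<close> for the \<open>q\<close>-th powers, the claim is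
  \<open>W * S' \<le> W' * S\<close>.\<close>

lemma share_mono:
  assumes "0 < q" "0 \<le> w" "w \<le> w'" "0 \<le> s'" "s' \<le> s" and "0 < w + s" "0 < w' + s'"
  shows "share q w s \<le> share q w' s'"
proof -
  have pos: "w powr q + s powr q > 0" "w' powr q + s' powr q > 0"
    using assms by (auto intro!: add_pos_nonneg add_nonneg_pos simp: less_le add_nonneg_eq_0_iff)
  have "w powr q * s' powr q \<le> w' powr q * s powr q"
    using assms by (intro mult_mono powr_mono2) auto
  then show ?thesis
    using pos by (simp add: share_def frac_le_eq divide_simps algebra_simps)
qed

text \<open>The membership formula uses squared distances with the exponent \<open>1 / (m - 1)\<close>; the square is
  the reason for the exponent \<open>2 / (m - 1)\<close>.\<close>

lemma inverse_ratio_eq_share: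
  assumes "m > 1" "0 < w" "0 < s"
  shows "inverse (1 + (s\<^sup>2 / w\<^sup>2) powr (1 / (m - 1))) = share (2 / (m - 1)) w s"
proof -
  have sq: "(u\<^sup>2) powr (1 / (m - 1)) = u powr (2 / (m - 1))" if "0 < u" for u :: real
    using that powr_powr[of u 2 "1 / (m - 1)"] by simp
  show ?thesis
    using assms by (simp add: share_def powr_divide sq field_simps)
qed

section \<open>Membership grades as functions of position\<close>

locale ordered_centroids =
  fixes k :: nat and m a b :: real and v :: "nat \<Rightarrow> real"
  assumes k_pos: "1 \<le> k" and m_gt_1: "m > 1" and v_0: "v 0 = a" and v_last: "v (k + 1) = b"
    and v_step: "\<And>j. j \<le> k \<Longrightarrow> v j < v (j + 1)"
begin

lemma v_less: "i < j \<Longrightarrow> j \<le> k + 1 \<Longrightarrow> v i < v j"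
proof (induction j)
  case (Suc j)
  then show ?case
    using v_step[of j] by (cases "i = j") auto
qed simp

lemma v_le: "i \<le> j \<Longrightarrow> j \<le> k + 1 \<Longrightarrow> v i \<le> v j"
  using v_less[of i j] by (cases "i = j") auto

lemma v_in_range: "j \<le> k + 1 \<Longrightarrow> v j \<in> {a..b}"
  using v_le[of 0 j] v_le[of j "k + 1"] v_0 v_last by auto

lemma between_centroids:
  assumes "t \<in> {a..b}"
  obtains c where "c \<le> k" "v c \<le> t" "t \<le> v (c + 1)"
proof -
  have "\<exists>c\<le>i. v c \<le> t \<and> t \<le> v (c + 1)" if "t \<le> v (i + 1)" for i
    using that
  proof (induction i)
    case 0
    then show ?case using assms v_0 by auto
  next
    case (Suc i)
    then show ?case
      by (cases "t \<le> v (i + 1)") (auto intro: le_SucI exI[of _ "Suc i"])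
  qed
  from this[of k] that show ?thesis
    using assms v_last by auto
qed

lemma cell_index_eq:
  assumes "c \<le> k" "v c \<le> t" "t < v (c + 1)"
  shows "cell_index k b v t = c"
proof -
  have "t < b"
    using assms v_le[of "c + 1" "k + 1"] v_last by simp
  moreover have "(THE j. j \<le> k \<and> v j \<le> t \<and> t < v (j + 1)) = c"
  proof (rule the_equality)
    fix j assume j: "j \<le> k \<and> v j \<le> t \<and> t < v (j + 1)"
    have "\<not> c + 1 \<le> j" "\<not> j + 1 \<le> c"
      using j assms v_le[of "c + 1" j] v_le[of "j + 1" c] by auto
    then show "j = c" by simp
  qed (use assms in simp)
  ultimately show ?thesis
    by (simp add: cell_index_def)
qed

text \<open>The membership matrix of the single data point \<open>t\<close>. Its row index is a dummy.\<close>

definition grade :: "nat \<Rightarrow> real \<Rightarrow> real" where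
  "grade j t = membership k m b (\<lambda>_. t) v 0 j"

lemma membership_eq_grade: "membership k m b x v i j = grade j (x i)"
  by (simp add: grade_def membership_def sq_dist_def Let_def)

lemma grade_centroid:
  assumes "1 \<le> c" "c \<le> k"
  shows "grade j (v c) = of_bool (j = c)"
  using assms cell_index_eq[of c "v c"] v_step[of c]
  by (simp add: grade_def membership_def sq_dist_def Let_def)

lemma grade_first:
  assumes "a \<le> t" "t \<le> v 1"
  shows "grade j t = of_bool (j = 1)"
proof (cases "t = v 1")
  case True
  then show ?thesis using grade_centroid k_pos by simp
next
  case False
  then show ?thesis
    using assms cell_index_eq[of 0 t] v_0 by (simp add: grade_def membership_def)
qed

lemma grade_last:
  assumes "v k \<le> t" "t \<le> b"
  shows "grade j t = of_bool (j = k)"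
proof -
  have "cell_index k b v t = k"
    using assms cell_index_eq[of k t] v_last by (cases "t = b") (auto simp: cell_index_def)
  then show ?thesis
    using k_pos by (simp add: grade_def membership_def)
qed

text \<open>The membership matrix assigns the right end point \<open>v (c + 1)\<close> to the next cell, yet the formula
  remains valid there. So the cells can be taken closed, and the monotonicity of the grades on
  them needs no separate treatment of the end points.\<close>

lemma grade_middle:
  assumes c: "1 \<le> c" "c < k" and t: "v c \<le> t" "t \<le> v (c + 1)"
  shows "grade j t =
    (if j = c then share (2 / (m - 1)) (v (c + 1) - t) (t - v c)
     else if j = c + 1 then share (2 / (m - 1)) (t - v c) (v (c + 1) - t) else 0)"
proof -
  consider "t = v c" | "t = v (c + 1)" | "v c < t" "t < v (c + 1)"
    using t by linarith
  then show ?thesis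
  proof cases
    case 1
    then show ?thesis
      using grade_centroid[of c j] c v_step[of c] by (simp add: share_def)
  next
    case 2
    then show ?thesis
      using grade_centroid[of "c + 1" j] c v_step[of c] by (simp add: share_def)
  next
    case 3
    then have "cell_index k b v t = c"
      using c by (intro cell_index_eq) auto
    then show ?thesis
      using c 3 inverse_ratio_eq_share[OF m_gt_1, of "v (c + 1) - t" "t - v c"]
        inverse_ratio_eq_share[OF m_gt_1, of "t - v c" "v (c + 1) - t"]
      by (simp add: grade_def membership_def sq_dist_def Let_def power2_commute[of t "v (Suc c)"])
  qed
qed

lemma grade_cases:
  assumes "t \<in> {a..b}"
  obtains (first) "t \<le> v 1"
  | (last) "v k \<le> t"
  | (middle) c where "1 \<le> c" "c < k" "v c \<le> t" "t \<le> v (c + 1)"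
proof -
  obtain c where c: "c \<le> k" "v c \<le> t" "t \<le> v (c + 1)"
    using assms by (rule between_centroids)
  then show thesis
    using first last middle[of c] by (cases "c = 0"; cases "c = k") auto
qed

lemma grade_bounds:
  assumes "t \<in> {a..b}"
  shows "grade j t \<in> {0..1}"
  using assms
proof (cases rule: grade_cases)
  case (middle c)
  then show ?thesis
    using share_bounds by (simp add: grade_middle)
qed (use assms in \<open>auto simp: grade_first grade_last\<close>)

lemma sum_grade:
  assumes "t \<in> {a..b}"
  shows "(\<Sum>j=1..k. grade j t) = 1"
  using assms
proof (cases rule: grade_cases)
  case (middle c)
  let ?q = "2 / (m - 1)"
  have "(\<Sum>j=1..k. grade j t) = (\<Sum>j\<in>{c, c + 1}. grade j t)"
    using middle by (intro sum.mono_neutral_right) (auto simp: grade_middle)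
  also have "\<dots> = share ?q (v (c + 1) - t) (t - v c) + share ?q (t - v c) (v (c + 1) - t)"
    using middle by (simp add: grade_middle)
  also have "\<dots> = 1"
    using v_step[of c] middle by (intro share_add) auto
  finally show ?thesis .
qed (use assms k_pos in \<open>auto simp: grade_first grade_last of_bool_def sum.delta\<close>)

text \<open>A point up to \<open>v (j - 1)\<close> lies in a cell that cluster \<open>j\<close> does not border, or it is the centroid
  \<open>v (j - 1)\<close> itself. The first cluster is excluded, because its grade at \<open>v 0 = a\<close> is one.\<close>

lemma grade_zero_left:
  assumes j: "2 \<le> j" "j \<le> k" and t: "a \<le> t" "t \<le> v (j - 1)"
  shows "grade j t = 0"
proof -
  have "j - 1 \<le> k + 1"
    using j by linarith
  then have "t \<in> {a..b}"
    using t v_in_range[of "j - 1"] by auto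
  then show ?thesis
  proof (cases rule: grade_cases)
    case first
    then show ?thesis using j t by (simp add: grade_first)
  next
    case last
    have "j - 1 < k"
      using j by linarith
    then show ?thesis
      using last t v_less[of "j - 1" k] by simp
  next
    case (middle c)
    show ?thesis
    proof (cases "c + 1 < j")
      case True
      then show ?thesis using middle by (simp add: grade_middle)
    next
      case False
      then have "j - 1 \<le> c"
        by linarith
      then have "t = v (j - 1)"
        using middle t v_le[of "j - 1" c] by simp
      then show ?thesis
        using grade_centroid[of "j - 1" j] j by simp
    qed
  qed
qed

lemma grade_zero_right:
  assumes j: "1 \<le> j" "j < k" and t: "v (j + 1) \<le> t" "t \<le> b"
  shows "grade j t = 0"
proof -
  have "t \<in> {a..b}"
    using t v_in_range[of "j + 1"] j by auto
  then show ?thesis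
  proof (cases rule: grade_cases)
    case first
    then show ?thesis using j t v_less[of 1 "j + 1"] by simp
  next
    case last
    then show ?thesis using j t by (simp add: grade_last)
  next
    case (middle c)
    show ?thesis
    proof (cases "j < c")
      case True
      then show ?thesis using middle j grade_middle[of c t j] by simp
    next
      case False
      then have "t = v (j + 1)"
        using middle t j v_le[of "c + 1" "j + 1"] by simp
      then show ?thesis
        using grade_centroid[of "j + 1" j] j by simp
    qed
  qed
qed

lemma grade_mono:
  assumes j: "1 \<le> j" "j \<le> k"
  shows "mono_on {v (j - 1)..v j} (grade j)"
proof (cases "j = 1")
  case True
  then show ?thesis
    using v_0 by (intro mono_onI) (simp add: grade_first)
next
  case False
  show ?thesis
  proof (rule mono_onI)
    fix s t assume "s \<in> {v (j - 1)..v j}" "t \<in> {v (j - 1)..v j}" "s \<le> t"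
    then show "grade j s \<le> grade j t"
      using False j m_gt_1 v_step[of "j - 1"] grade_middle[of "j - 1" s j] grade_middle[of "j - 1" t j]
      by (auto intro!: share_mono)
  qed
qed

lemma grade_antimono:
  assumes j: "1 \<le> j" "j \<le> k"
  shows "antimono_on {v j..v (j + 1)} (grade j)"
proof (cases "j = k")
  case True
  then show ?thesis
    using v_last by (intro monotone_onI) (simp add: grade_last)
next
  case False
  show ?thesis
  proof (rule monotone_onI)
    fix s t assume "s \<in> {v j..v (j + 1)}" "t \<in> {v j..v (j + 1)}" "s \<le> t"
    then show "grade j t \<le> grade j s"
      using False j m_gt_1 v_step[of j] grade_middle[of j s j] grade_middle[of j t j]
      by (auto intro!: share_mono)
  qed
qed

end

section \<open>The interpolated membership functions\<close>

locale clustering = ordered_centroids +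
  fixes n :: nat and x :: "nat \<Rightarrow> real"
begin

definition knots :: "real set" where
  "knots = x ` {1..n} \<union> v ` {1..k} \<union> {a, b}"

abbreviation cluster :: "nat \<Rightarrow> real \<Rightarrow> real" where
  "cluster \<equiv> cluster_fun n k m a b x v"

lemma v_knot: "j \<le> k + 1 \<Longrightarrow> v j \<in> knots"
  using v_0 v_last by (cases "j = 0"; cases "j = k + 1") (auto simp: knots_def)

lemma knot_interval: "i \<le> k + 1 \<Longrightarrow> j \<le> k + 1 \<Longrightarrow> knot_interval knots (v i) (v j)"
  using v_knot by unfold_locales (auto simp: knots_def)

text \<open>The special ordinates prescribed at the centroids and at the end points agree with the grades
  there, so that the three kinds of nodes need not be distinguished any more.\<close>

lemma nodes_eq_graph: "nodes n k m a b x v j = graph_on knots (grade j)"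
proof -
  have "a \<le> v 1" "v k \<le> b"
    using v_in_range[of 1] v_in_range[of k] k_pos by auto
  then have "grade j a = (if j = 1 then 1 else 0)" "grade j b = (if j = k then 1 else 0)"
    by (simp_all add: grade_first grade_last)
  moreover have "(\<lambda>l. (v l, if l = j then 1 else 0)) ` {1..k} = (\<lambda>l. (v l, grade j (v l))) ` {1..k}"
    by (intro image_cong) (auto simp: grade_centroid)
  ultimately show ?thesis
    by (simp add: nodes_def graph_on_def knots_def membership_eq_grade image_Un image_image)
qed

lemma cluster_eq: "t \<in> {a..b} \<Longrightarrow> cluster j t = pw_linear (graph_on knots (grade j)) t"
  by (simp add: cluster_fun_def nodes_eq_graph)

lemma cell_subset: "i \<le> k + 1 \<Longrightarrow> j \<le> k + 1 \<Longrightarrow> {v i..v j} \<subseteq> {a..b}"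
  using v_in_range[of i] v_in_range[of j] by auto

lemma cluster_bounds: "cluster j t \<in> {0..1}"
proof (cases "t \<in> {a..b}")
  case True
  interpret knot_interval knots a b
    using knot_interval[of 0 "k + 1"] v_0 v_last by simp
  show ?thesis
    unfolding cluster_eq[OF True] using True grade_bounds by (intro pw_linear_bounds) auto
next
  case False
  then show ?thesis by (auto simp: cluster_fun_def)
qed

lemma cluster_peak:
  assumes "1 \<le> j" "j \<le> k"
  shows "cluster j (v j) = 1"
proof -
  interpret knot_interval knots "v j" "v j"
    using assms by (intro knot_interval) auto
  show ?thesis
    using assms v_in_range[of j] v_knot[of j]
    by (simp add: cluster_eq pw_linear_at_knot grade_centroid)
qed

lemma cluster_mono:
  assumes "1 \<le> j" "j \<le> k"
  shows "mono_on {v (j - 1)..v j} (cluster j)"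
proof -
  interpret knot_interval knots "v (j - 1)" "v j"
    using assms by (intro knot_interval) auto
  have "mono_on {v (j - 1)..v j} (pw_linear (graph_on knots (grade j)))"
    using grade_mono[OF assms] by (intro pw_linear_mono) (auto simp: monotone_on_def)
  then show ?thesis
    using cell_subset[of "j - 1" j] assms by (simp add: monotone_on_def cluster_eq subset_iff)
qed

lemma cluster_antimono:
  assumes "1 \<le> j" "j \<le> k"
  shows "antimono_on {v j..v (j + 1)} (cluster j)"
proof -
  interpret knot_interval knots "v j" "v (j + 1)"
    using assms by (intro knot_interval) auto
  have "antimono_on {v j..v (j + 1)} (pw_linear (graph_on knots (grade j)))"
    using grade_antimono[OF assms] by (intro pw_linear_antimono) (auto simp: monotone_on_def)
  then show ?thesis
    using cell_subset[of j "j + 1"] assms by (simp add: monotone_on_def cluster_eq subset_iff)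
qed

text \<open>The inequality is strict because of \<open>j = 1\<close>: that function jumps from \<open>0\<close> to \<open>1\<close> at \<open>v 0 = a\<close>.\<close>

lemma cluster_zero_left:
  assumes j: "1 \<le> j" "j \<le> k" and t: "t < v (j - 1)"
  shows "cluster j t = 0"
proof (cases "a \<le> t")
  case True
  then have "2 \<le> j"
    using t v_0 j by (cases "j = 1") auto
  interpret knot_interval knots a "v (j - 1)"
    using knot_interval[of 0 "j - 1"] v_0 j by simp
  have "pw_linear (graph_on knots (grade j)) t \<in> {0..0}"
    using grade_zero_left[OF \<open>2 \<le> j\<close>] j t True by (intro pw_linear_bounds) auto
  moreover have "j - 1 \<le> k + 1"
    using j by linarith
  then have "t \<in> {a..b}"
    using True t v_in_range[of "j - 1"] by auto
  ultimately show ?thesis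
    by (simp add: cluster_eq)
qed (simp add: cluster_fun_def)

lemma cluster_zero_right:
  assumes j: "1 \<le> j" "j \<le> k" and t: "v (j + 1) < t"
  shows "cluster j t = 0"
proof (cases "t \<le> b")
  case True
  then have "j < k"
    using t v_last j by (cases "j = k") auto
  interpret knot_interval knots "v (j + 1)" b
    using knot_interval[of "j + 1" "k + 1"] v_last j by simp
  have "pw_linear (graph_on knots (grade j)) t \<in> {0..0}"
    using grade_zero_right[OF _ \<open>j < k\<close>] j t True by (intro pw_linear_bounds) auto
  then show ?thesis
    using True t v_in_range[of "j + 1"] j by (simp add: cluster_eq)
qed (simp add: cluster_fun_def)

text \<open>Outside the two cells around \<open>v j\<close> the function is zero, its least possible value; so the
  monotonicity on each of these cells extends to a half-line.\<close>

lemma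
  assumes j: "1 \<le> j" "j \<le> k"
  shows cluster_fuzzy_number: "fuzzy_number (cluster j)"
    and cluster_support: "alpha_cut (cluster j) 0 \<subseteq> {v (j - 1)..v (j + 1)}"
proof -
  have up: "mono_on {..v j} (cluster j)"
  proof (rule mono_onI)
    fix s t assume "s \<in> {..v j}" "t \<in> {..v j}" "s \<le> t"
    then show "cluster j s \<le> cluster j t"
      using cluster_zero_left[OF j, of s] cluster_bounds[of j t]
      by (cases "s < v (j - 1)") (auto intro: mono_onD[OF cluster_mono[OF j]])
  qed
  have down: "antimono_on {v j..} (cluster j)"
  proof (rule monotone_onI)
    fix s t assume "s \<in> {v j..}" "t \<in> {v j..}" "s \<le> t"
    then show "cluster j t \<le> cluster j s"
      using cluster_zero_right[OF j, of t] cluster_bounds[of j s]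
      by (cases "v (j + 1) < t") (auto intro: monotone_onD[OF cluster_antimono[OF j]])
  qed
  have outside: "cluster j t = 0" if "t \<notin> {v (j - 1)..v (j + 1)}" for t
    using that cluster_zero_left[OF j] cluster_zero_right[OF j] by force
  show "fuzzy_number (cluster j)" "alpha_cut (cluster j) 0 \<subseteq> {v (j - 1)..v (j + 1)}"
    using unimodal_imp_fuzzy_number[OF cluster_bounds cluster_peak[OF j] up down outside] by auto
qed

lemma sum_cluster:
  assumes "t \<in> {a..b}"
  shows "(\<Sum>j=1..k. cluster j t) = 1"
proof -
  interpret knot_interval knots a b
    using knot_interval[of 0 "k + 1"] v_0 v_last by simp
  have "pw_linear (graph_on knots (\<lambda>s. \<Sum>j=1..k. grade j s)) t \<in> {1..1}"
    using sum_grade by (intro pw_linear_bounds assms) auto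
  then show ?thesis
    using assms by (simp add: cluster_eq pw_linear_sum)
qed

end

theorem theorem3:
  fixes n k :: nat and m a b :: real and x v :: "nat \<Rightarrow> real"
  assumes "k \<ge> 2" and "n \<ge> 1" and "m > 1" and "a < b"
    and "\<And>i. i \<in> {1..n} \<Longrightarrow> x i \<in> {a..b}"
    and "v 0 = a" and "v (k + 1) = b"
    and "a < v 1" and "\<And>j. j \<in> {1..<k} \<Longrightarrow> v j < v (j + 1)" and "v k < b"
  shows "(\<forall>j\<in>{1..k}.
            cluster_fun n k m a b x v j (v j) = 1 \<and>
            alpha_cut (cluster_fun n k m a b x v j) 0 \<subseteq> {v (j - 1)..v (j + 1)} \<and>
            mono_on {v (j - 1)..v j} (cluster_fun n k m a b x v j) \<and>
            antimono_on {v j..v (j + 1)} (cluster_fun n k m a b x v j) \<and>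
            fuzzy_number (cluster_fun n k m a b x v j)) \<and>
         fuzzy_partition k (cluster_fun n k m a b x v) a b"
proof -
  have step: "v j < v (j + 1)" if "j \<le> k" for j
    using that assms(6-8,10) assms(9)[of j] by (cases "j = 0"; cases "j = k") auto
  interpret clustering k m a b v n x
    using assms(1,3,6,7) step by unfold_locales auto
  show ?thesis
    using cluster_peak cluster_support cluster_mono cluster_antimono cluster_fuzzy_number sum_cluster
    by (simp add: fuzzy_partition_def)
qed

end
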